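(* Let $L$ be a Leibniz algebra over a field that is nilpotent of length $3$ or less. Then each element of $M(L)$ is contained in exactly one Cartan subalgebra of $L$.
   Context: Leibniz algebras are finite-dimensional left Leibniz algebras over a field: the product satisfies $x(yz)=(xy)z+y(xz)$. The normalizer of a subalgebra $C$ in $L$ is $\mathcal{N}_L(C)=\{x\in L: xC\subseteq C \text{ and } Cx\subseteq C\}$; $C$ is self-normalizing in $L$ if $\mathcal{N}_L(C)=C$. A Cartan subalgebra of $L$ is a nilpotent self-normalizing subalgebra. $M(L)$ is the set of subalgebras $A$ of $L$ such that: (1) $A$ can be joined to $L$ by a (finite, possibly trivial) chain of subalgebras of $L$, each maximal and self-normalizing in the next; and (2) no maximal subalgebra of $A$ is self-normalizing in $A$. The algebra $L$ is nilpotent of length $t$ if $t$ is the smallest natural number such that there is a chain of ideals $0=L_0\subseteq L_1\subseteq\cdots\subseteq L_t=L$ of $L$ with every factor $L_{i+1}/L_i$ nilpotent. *)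

theory Defs
  imports Complex_Main
begin

text \<open>
  Algebras with explicit carrier and operations.  Subalgebras and quotients, whose elements are
  cosets and hence live on a different type, are both instances, so that nilpotency is defined
  once for all of them.
\<close>

record ('k, 'a) algebra_struct =
  carr :: "'a set"
  zer :: 'a
  add :: "'a \<Rightarrow> 'a \<Rightarrow> 'a"
  smul :: "'k \<Rightarrow> 'a \<Rightarrow> 'a"
  mul :: "'a \<Rightarrow> 'a \<Rightarrow> 'a"

inductive_set lin_span :: "('k, 'a) algebra_struct \<Rightarrow> 'a set \<Rightarrow> 'a set"
  for V :: "('k, 'a) algebra_struct" and S :: "'a set" where
  lin_span_zero: "zer V \<in> lin_span V S"
| lin_span_base: "x \<in> S \<Longrightarrow> x \<in> lin_span V S"
| lin_span_add: "x \<in> lin_span V S \<Longrightarrow> y \<in> lin_span V S \<Longrightarrow> add V x y \<in> lin_span V S"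
| lin_span_smul: "x \<in> lin_span V S \<Longrightarrow> smul V c x \<in> lin_span V S"

text \<open>
  Lower central series; index 0 is the algebra itself.  In a left Leibniz algebra the
  right-normed products \<open>x\<^sub>1 (x\<^sub>2 (\<dots> x\<^sub>n))\<close> span all products of \<open>n\<close> factors, hence the
  products are taken with the whole algebra on the left.
\<close>

primrec lower_central :: "('k, 'a) algebra_struct \<Rightarrow> nat \<Rightarrow> 'a set" where
  "lower_central V 0 = carr V"
| "lower_central V (Suc n) =
     lin_span V {mul V x y | x y. x \<in> carr V \<and> y \<in> lower_central V n}"

definition nilpotent_algebra :: "('k, 'a) algebra_struct \<Rightarrow> bool" where
  "nilpotent_algebra V \<longleftrightarrow> (\<exists>n. lower_central V n = {zer V})"

text \<open>The algebra is the whole type \<open>'v\<close>, its subalgebras are sets.\<close>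

locale leibniz_algebra = vector_space scale
  for scale :: "'k::field \<Rightarrow> 'v::ab_group_add \<Rightarrow> 'v" +
  fixes mult :: "'v \<Rightarrow> 'v \<Rightarrow> 'v"  (infixl "\<cdot>" 70)
  assumes finite_dim: "\<exists>B. finite B \<and> span B = UNIV"
    and linear_mult_right: "Vector_Spaces.linear scale scale (\<lambda>y. x \<cdot> y)"
    and linear_mult_left: "Vector_Spaces.linear scale scale (\<lambda>x. x \<cdot> y)"
    and left_leibniz: "x \<cdot> (y \<cdot> z) = (x \<cdot> y) \<cdot> z + y \<cdot> (x \<cdot> z)"
begin

definition subalgebra :: "'v set \<Rightarrow> bool" where
  "subalgebra A \<longleftrightarrow> subspace A \<and> (\<forall>x\<in>A. \<forall>y\<in>A. x \<cdot> y \<in> A)"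

definition is_ideal :: "'v set \<Rightarrow> bool" where
  "is_ideal I \<longleftrightarrow> subspace I \<and> (\<forall>x. \<forall>y\<in>I. x \<cdot> y \<in> I \<and> y \<cdot> x \<in> I)"

definition normalizer :: "'v set \<Rightarrow> 'v set \<Rightarrow> 'v set" where
  "normalizer B C = {x \<in> B. \<forall>c\<in>C. x \<cdot> c \<in> C \<and> c \<cdot> x \<in> C}"

definition self_normalizing :: "'v set \<Rightarrow> 'v set \<Rightarrow> bool" where
  "self_normalizing C B \<longleftrightarrow> normalizer B C = C"

definition maximal_subalgebra :: "'v set \<Rightarrow> 'v set \<Rightarrow> bool" where
  "maximal_subalgebra C B \<longleftrightarrow> subalgebra C \<and> subalgebra B \<and> C \<subset> B \<and>
     \<not> (\<exists>D. subalgebra D \<and> C \<subset> D \<and> D \<subset> B)"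

definition restrict_algebra :: "'v set \<Rightarrow> ('k, 'v) algebra_struct" where
  "restrict_algebra A = \<lparr>carr = A, zer = 0, add = (+), smul = scale, mul = (\<cdot>)\<rparr>"

definition coset :: "'v set \<Rightarrow> 'v \<Rightarrow> 'v set" where
  "coset I x = (+) x ` I"

text \<open>
  The quotient \<open>A/I\<close>.  Each operation is the union over all representatives; when \<open>I\<close> is an ideal
  this is a single coset (see the lemmas below).
\<close>

definition quotient_algebra :: "'v set \<Rightarrow> 'v set \<Rightarrow> ('k, 'v set) algebra_struct" where
  "quotient_algebra A I =
     \<lparr>carr = coset I ` A,
      zer = I,
      add = (\<lambda>X Y. \<Union>x\<in>X. \<Union>y\<in>Y. coset I (x + y)),
      smul = (\<lambda>c X. \<Union>x\<in>X. coset I (scale c x)),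
      mul = (\<lambda>X Y. \<Union>x\<in>X. \<Union>y\<in>Y. coset I (x \<cdot> y))\<rparr>"

definition cartan_subalgebra :: "'v set \<Rightarrow> bool" where
  "cartan_subalgebra C \<longleftrightarrow> subalgebra C \<and> nilpotent_algebra (restrict_algebra C) \<and>
     self_normalizing C UNIV"

definition M_set :: "'v set set" where
  "M_set = {A. subalgebra A \<and>
     (\<exists>n C. C 0 = A \<and> C n = UNIV \<and>
        (\<forall>i<n. maximal_subalgebra (C i) (C (Suc i)) \<and> self_normalizing (C i) (C (Suc i)))) \<and>
     \<not> (\<exists>B. maximal_subalgebra B A \<and> self_normalizing B A)}"

definition nilpotent_series :: "nat \<Rightarrow> (nat \<Rightarrow> 'v set) \<Rightarrow> bool" where
  "nilpotent_series t I \<longleftrightarrow> I 0 = {0} \<and> I t = UNIV \<and> (\<forall>i\<le>t. is_ideal (I i)) \<and>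
     (\<forall>i<t. I i \<subseteq> I (Suc i) \<and> nilpotent_algebra (quotient_algebra (I (Suc i)) (I i)))"

definition nilpotent_of_length :: "nat \<Rightarrow> bool" where
  "nilpotent_of_length t \<longleftrightarrow>
     (\<exists>I. nilpotent_series t I) \<and> (\<forall>s<t. \<not> (\<exists>I. nilpotent_series s I))"

lemma mult_add_right: "x \<cdot> (y + z) = x \<cdot> y + x \<cdot> z"
  using linear_mult_right[of x]
  by (simp add: Vector_Spaces.linear_def module_hom_def module_hom_axioms_def)

lemma mult_add_left: "(x + y) \<cdot> z = x \<cdot> z + y \<cdot> z"
  using linear_mult_left[of z]
  by (simp add: Vector_Spaces.linear_def module_hom_def module_hom_axioms_def)

lemma coset_self: "subspace I \<Longrightarrow> x \<in> coset I x"
  unfolding coset_def using subspace_0[of I] by (auto intro: image_eqI[where x = 0])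

lemma mem_coset_iff: "y \<in> coset I x \<longleftrightarrow> y - x \<in> I"
proof
  assume "y \<in> coset I x"
  then show "y - x \<in> I" by (auto simp: coset_def)
next
  assume "y - x \<in> I"
  moreover have "y = x + (y - x)" by simp
  ultimately show "y \<in> coset I x" unfolding coset_def by blast
qed

lemma coset_eq_iff:
  assumes "subspace I"
  shows "coset I x = coset I y \<longleftrightarrow> x - y \<in> I"
proof
  assume "coset I x = coset I y"
  then show "x - y \<in> I"
    using coset_self[OF assms, of x] by (simp add: mem_coset_iff)
next
  assume d: "x - y \<in> I"
  have "z - x \<in> I \<longleftrightarrow> z - y \<in> I" for z
    using subspace_add[OF assms d, of "z - x"] subspace_diff[OF assms _ d, of "z - y"] by auto
  then show "coset I x = coset I y" by (auto simp: mem_coset_iff)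
qed

lemma quotient_add_coset:
  assumes "subspace I"
  shows "add (quotient_algebra A I) (coset I x) (coset I y) = coset I (x + y)"
proof -
  have "coset I (x' + y') = coset I (x + y)" if "x' \<in> coset I x" "y' \<in> coset I y" for x' y'
  proof -
    have "(x' - x) + (y' - y) \<in> I"
      using that by (intro subspace_add[OF assms]) (simp_all add: mem_coset_iff)
    moreover have "(x' - x) + (y' - y) = x' + y' - (x + y)" by simp
    ultimately show ?thesis by (simp only: coset_eq_iff[OF assms])
  qed
  moreover have "coset I x \<noteq> {}" "coset I y \<noteq> {}"
    using coset_self[OF assms] by blast+
  ultimately show ?thesis
    by (simp add: quotient_algebra_def)
qed

lemma quotient_smul_coset:
  assumes "subspace I"
  shows "smul (quotient_algebra A I) c (coset I x) = coset I (scale c x)"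
proof -
  have "coset I (scale c x') = coset I (scale c x)" if "x' \<in> coset I x" for x'
    using that subspace_scale[OF assms, of "x' - x" c]
    by (simp add: coset_eq_iff[OF assms] mem_coset_iff scale_right_diff_distrib)
  moreover have "coset I x \<noteq> {}"
    using coset_self[OF assms] by blast
  ultimately show ?thesis
    by (simp add: quotient_algebra_def)
qed

lemma quotient_mul_coset:
  assumes "is_ideal I"
  shows "mul (quotient_algebra A I) (coset I x) (coset I y) = coset I (x \<cdot> y)"
proof -
  have sub: "subspace I" using assms by (simp add: is_ideal_def)
  have "coset I (x' \<cdot> y') = coset I (x \<cdot> y)" if "x' \<in> coset I x" "y' \<in> coset I y" for x' y'
  proof -
    have x': "x' - x \<in> I" and y': "y' - y \<in> I" using that by (simp_all add: mem_coset_iff)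
    have "x' \<cdot> y' = x' \<cdot> (y' - y) + x' \<cdot> y"
      using mult_add_right[of x' "y' - y" y] by simp
    moreover have "x' \<cdot> y = (x' - x) \<cdot> y + x \<cdot> y"
      using mult_add_left[of "x' - x" x y] by simp
    ultimately have "x' \<cdot> y' - x \<cdot> y = x' \<cdot> (y' - y) + (x' - x) \<cdot> y"
      by (simp add: algebra_simps)
    moreover have "x' \<cdot> (y' - y) \<in> I" "(x' - x) \<cdot> y \<in> I"
      using assms x' y' by (auto simp: is_ideal_def)
    ultimately show ?thesis
      using subspace_add[OF sub] by (simp add: coset_eq_iff[OF sub])
  qed
  moreover have "coset I x \<noteq> {}" "coset I y \<noteq> {}"
    using coset_self[OF sub] by blast+
  ultimately show ?thesis
    by (simp add: quotient_algebra_def)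
qed

end

end

theory Submission
  imports Defs
begin

text \<open>
  An element \<open>A\<close> of \<open>M(L)\<close> is nilpotent, so every Cartan subalgebra containing \<open>A\<close> lies in the
  Fitting null component \<open>D\<close> of \<open>L\<close> under left multiplication by \<open>A\<close>, and \<open>D\<close> is
  self-normalizing.  It therefore suffices that \<open>D\<close> is nilpotent.  For a nilpotent ideal \<open>I\<close> such
  that \<open>L/I\<close> has nilpotent length at most 2, the image of \<open>A\<close> in \<open>L/I\<close> is its own Fitting null
  component, by going up the chain from \<open>A\<close> to \<open>L\<close>.  Hence \<open>D \<subseteq> A + I\<close>, and \<open>D\<close> is nilpotent since
  \<open>A\<close> acts nilpotently on it and \<open>D \<inter> I\<close> is a nilpotent ideal of \<open>D\<close>.
\<close>

context leibniz_algebra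
begin

section \<open>Bilinearity, the Leibniz identity, subalgebras and normalizers\<close>

lemma mult_scale_right: "x \<cdot> scale c y = scale c (x \<cdot> y)"
  using linear_mult_right[of x]
  by (simp add: Vector_Spaces.linear_def module_hom_def module_hom_axioms_def)

lemma mult_scale_left: "scale c x \<cdot> y = scale c (x \<cdot> y)"
  using linear_mult_left[of y]
  by (simp add: Vector_Spaces.linear_def module_hom_def module_hom_axioms_def)

lemma mult_zero_right [simp]: "x \<cdot> 0 = 0"
  using mult_add_right[of x 0 0] by simp

lemma mult_zero_left [simp]: "0 \<cdot> x = 0"
  using mult_add_left[of 0 0 x] by simp

lemma mult_diff_right: "x \<cdot> (y - z) = x \<cdot> y - x \<cdot> z"
  using mult_add_right[of x "y - z" z] by (simp add: algebra_simps)

lemma mult_diff_left: "(x - y) \<cdot> z = x \<cdot> z - y \<cdot> z"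
  using mult_add_left[of "x - y" y z] by (simp add: algebra_simps)

lemma left_leibniz': "(x \<cdot> y) \<cdot> z = x \<cdot> (y \<cdot> z) - y \<cdot> (x \<cdot> z)"
  by (simp add: left_leibniz[of x y z])

text \<open>As left multiplications, \<open>x \<cdot> y\<close> and \<open>y \<cdot> x\<close> are
  opposite commutators. This stands in for the anticommutativity of Lie algebras.\<close>

lemma sym_product_annihilates: "(x \<cdot> y + y \<cdot> x) \<cdot> z = 0"
  by (simp add: mult_add_left left_leibniz')

lemma subalgebra_UNIV: "subalgebra UNIV"
  by (simp add: subalgebra_def)

lemma subalgebra_subspace: "subalgebra A \<Longrightarrow> subspace A"
  by (simp add: subalgebra_def)

lemma subalgebra_mult: "subalgebra A \<Longrightarrow> x \<in> A \<Longrightarrow> y \<in> A \<Longrightarrow> x \<cdot> y \<in> A"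
  by (simp add: subalgebra_def)

lemma maximal_subalgebraD:
  assumes "maximal_subalgebra M B"
  shows "subalgebra M" "subalgebra B" "M \<subseteq> B" "M \<noteq> B"
    and "subalgebra D \<Longrightarrow> M \<subseteq> D \<Longrightarrow> D \<subseteq> B \<Longrightarrow> D = M \<or> D = B"
  using assms unfolding maximal_subalgebra_def by blast+

lemma subalgebra_normalizer:
  assumes "subalgebra B" "subspace C"
  shows "subalgebra (normalizer B C)"
  unfolding subalgebra_def
proof (intro conjI ballI)
  show "subspace (normalizer B C)"
    using subalgebra_subspace[OF assms(1)] assms(2)
    by (auto simp: subspace_def normalizer_def mult_add_left mult_add_right
        mult_scale_left mult_scale_right)
  show "x \<cdot> y \<in> normalizer B C" if "x \<in> normalizer B C" "y \<in> normalizer B C" for x y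
  proof -
    have "(x \<cdot> y) \<cdot> c \<in> C" if "c \<in> C" for c
      using that \<open>x \<in> _\<close> \<open>y \<in> _\<close> subspace_diff[OF assms(2)]
      by (simp add: normalizer_def left_leibniz')
    moreover have "c \<cdot> (x \<cdot> y) \<in> C" if "c \<in> C" for c
      unfolding left_leibniz[of c x y]
      using that \<open>x \<in> _\<close> \<open>y \<in> _\<close> subspace_add[OF assms(2)]
      by (simp add: normalizer_def)
    ultimately show ?thesis
      using that subalgebra_mult[OF assms(1)] by (simp add: normalizer_def)
  qed
qed

subsection \<open>Finite dimension\<close>

lemma ex_finite_basis: "\<exists>B. finite B \<and> independent B \<and> span B = UNIV"
proof -
  obtain B where B: "finite B" "span B = UNIV" using finite_dim by blast
  obtain C where C: "C \<subseteq> B" "independent C" "B \<subseteq> span C"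
    by (rule maximal_independent_subset[of B])
  have "span C = UNIV"
    using B(2) span_minimal[OF C(3) subspace_span] by auto
  then show ?thesis using C(2) finite_subset[OF C(1) B(1)] by blast
qed

lemma subspace_eq_of_dim_le:
  assumes "subspace S" "subspace T" "S \<subseteq> T" "dim T \<le> dim S"
  shows "S = T"
proof -
  obtain B where B: "finite B" "independent B" "span B = UNIV" using ex_finite_basis by blast
  interpret finite_dimensional_vector_space scale B
    by unfold_locales fact+
  show ?thesis by (rule subspace_dim_equal) fact+
qed

lemma dim_bounded: "dim S \<le> dim UNIV"
proof -
  obtain B where B: "finite B" "independent B" "span B = UNIV" using ex_finite_basis by blast
  interpret finite_dimensional_vector_space scale B
    by unfold_locales fact+
  show ?thesis by (rule dim_subset) simp
qed

text \<open>Dimensions are bounded, so some subspace with the property has greatest dimension, and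
  none with the property contains it properly.\<close>

lemma ex_maximal_subspace:
  assumes "P W" and "\<And>W. P W \<Longrightarrow> subspace W"
  obtains W where "P W" "\<And>W'. P W' \<Longrightarrow> W \<subseteq> W' \<Longrightarrow> W' = W"
proof -
  obtain W where "P W" "\<forall>W'. P W' \<longrightarrow> dim W' \<le> dim W"
    using ex_has_greatest_nat[of P W dim "Suc (dim UNIV)"] assms(1) dim_bounded
    by (auto simp: less_Suc_eq_le)
  then show thesis using subspace_eq_of_dim_le assms(2) that by metis
qed

lemma ex_minimal_subspace:
  assumes "P W" and "\<And>W. P W \<Longrightarrow> subspace W"
  obtains W where "P W" "\<And>W'. P W' \<Longrightarrow> W' \<subseteq> W \<Longrightarrow> W' = W"
proof -
  obtain W where "P W" "\<forall>W'. P W' \<longrightarrow> dim W \<le> dim W'"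
    using ex_has_least_nat[of P W dim] assms(1) by blast
  then show thesis using subspace_eq_of_dim_le assms(2) that by metis
qed

subsection \<open>Iterated left multiplication\<close>

text \<open>
  For an ideal \<open>H\<close>, \<open>lnil H S\<close> is the preimage of the Fitting null component of the quotient by
  \<open>H\<close> under \<open>S\<close>, which replaces working in quotient algebras.
\<close>

primrec lseries :: "'v set \<Rightarrow> 'v set \<Rightarrow> nat \<Rightarrow> 'v set" where
  "lseries H S 0 = H"
| "lseries H S (Suc n) = {x. \<forall>s\<in>S. s \<cdot> x \<in> lseries H S n}"

definition lnil :: "'v set \<Rightarrow> 'v set \<Rightarrow> 'v set" where
  "lnil H S = (\<Union>n. lseries H S n)"

lemma lseries_mono: "H \<subseteq> H' \<Longrightarrow> S' \<subseteq> S \<Longrightarrow> lseries H S n \<subseteq> lseries H' S' n"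
  by (induction n) auto

lemma lnil_mono: "H \<subseteq> H' \<Longrightarrow> S' \<subseteq> S \<Longrightarrow> lnil H S \<subseteq> lnil H' S'"
  using lseries_mono[of H H' S' S] unfolding lnil_def by (intro UN_mono) auto

lemma lseries_relative:
  assumes "\<And>s v. s \<in> S \<Longrightarrow> v \<in> V \<Longrightarrow> s \<cdot> v \<in> V"
  shows "V \<inter> lseries H S n \<subseteq> lseries (H \<inter> V) S n"
  by (induction n) (use assms in auto)

lemma lnil_relative:
  assumes "\<And>s v. s \<in> S \<Longrightarrow> v \<in> V \<Longrightarrow> s \<cdot> v \<in> V"
  shows "V \<inter> lnil H S \<subseteq> lnil (H \<inter> V) S"
  using lseries_relative[of S V H, OF assms] by (auto simp: lnil_def)

lemma subspace_lseries: "subspace H \<Longrightarrow> subspace (lseries H S n)"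
  by (induction n) (auto simp: subspace_def mult_add_right mult_scale_right)

lemma lseries_le:
  assumes "\<And>s h. s \<in> S \<Longrightarrow> h \<in> H \<Longrightarrow> s \<cdot> h \<in> H" "m \<le> n"
  shows "lseries H S m \<subseteq> lseries H S n"
proof -
  have "lseries H S k \<subseteq> lseries H S (Suc k)" for k
    by (induction k) (use assms(1) in auto)
  then show ?thesis using lift_Suc_mono_le[of "lseries H S"] assms(2) by blast
qed

lemma subspace_lnil:
  assumes "subspace H" "\<And>s h. s \<in> S \<Longrightarrow> h \<in> H \<Longrightarrow> s \<cdot> h \<in> H"
  shows "subspace (lnil H S)"
  unfolding subspace_def
proof (intro conjI ballI allI)
  note sub = subspace_lseries[OF assms(1)]
  show "0 \<in> lnil H S"
    unfolding lnil_def using subspace_0[OF sub] by blast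
  show "scale c x \<in> lnil H S" if "x \<in> lnil H S" for c x
    using that subspace_scale[OF sub] unfolding lnil_def by blast
  fix x y assume "x \<in> lnil H S" "y \<in> lnil H S"
  then obtain m n where "x \<in> lseries H S m" "y \<in> lseries H S n"
    unfolding lnil_def by blast
  then have "x \<in> lseries H S (m + n)" "y \<in> lseries H S (m + n)"
    using lseries_le[of S H m "m + n"] lseries_le[of S H n "m + n"] assms(2) by auto
  then show "x + y \<in> lnil H S"
    using subspace_add[OF sub] unfolding lnil_def by blast
qed

text \<open>The increasing terms of \<open>lseries\<close> become stationary in finite dimension, so
  one exponent serves all elements.\<close>

lemma lnil_uniform:
  assumes "subspace H" "\<And>s h. s \<in> S \<Longrightarrow> h \<in> H \<Longrightarrow> s \<cdot> h \<in> H"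
  obtains n where "lnil H S = lseries H S n"
proof -
  obtain W where "\<exists>n. W = lseries H S n"
    and W: "\<And>W'. \<exists>n. W' = lseries H S n \<Longrightarrow> W \<subseteq> W' \<Longrightarrow> W' = W"
    by (rule ex_maximal_subspace[of "\<lambda>W. \<exists>n. W = lseries H S n" "lseries H S 0"])
      (use subspace_lseries[OF assms(1)] in blast)+
  then obtain n where n: "\<And>m. lseries H S n \<subseteq> lseries H S m \<Longrightarrow> lseries H S m = lseries H S n"
    by metis
  have "lseries H S m \<subseteq> lseries H S n" for m
    using n[of "m + n"] lseries_le[of S H m "m + n"] lseries_le[of S H n "m + n"] assms(2)
    by auto
  then show thesis using that unfolding lnil_def by blast
qed

text \<open>Left multiplications are derivations: when \<open>m + n\<close> of them are applied to
  \<open>x \<cdot> y\<close>, every term of the expansion applies at least \<open>m\<close> to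
  \<open>x\<close> or at least \<open>n\<close> to \<open>y\<close>. The induction lowers one
  exponent in each summand.\<close>

lemma lnil_mult:
  assumes "subspace H" "subalgebra B" "S \<subseteq> B"
    and "\<And>b h. b \<in> B \<Longrightarrow> h \<in> H \<Longrightarrow> b \<cdot> h \<in> H \<and> h \<cdot> b \<in> H"
    and x: "x \<in> B \<inter> lnil H S" and y: "y \<in> B \<inter> lnil H S"
  shows "x \<cdot> y \<in> lnil H S"
proof -
  have "x \<cdot> y \<in> lseries H S (m + n)"
    if "x \<in> B" "y \<in> B" "x \<in> lseries H S m" "y \<in> lseries H S n" for m n x y
    using that
  proof (induction "m + n" arbitrary: m n x y rule: less_induct)
    case less
    have mono: "lseries H S 0 \<subseteq> lseries H S (m + n)"
      by (rule lseries_le) (use assms in auto)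
    show ?case
    proof (cases "m = 0 \<or> n = 0")
      case True
      then have "x \<cdot> y \<in> H" using less.prems assms(4) by auto
      then show ?thesis using mono by auto
    next
      case False
      then obtain m' n' where mn: "m = Suc m'" "n = Suc n'" by (meson not0_implies_Suc)
      have "s \<cdot> (x \<cdot> y) \<in> lseries H S (m' + n)" if s: "s \<in> S" for s
      proof -
        have "(s \<cdot> x) \<cdot> y \<in> lseries H S (m' + n)"
          using less.hyps[of m' n "s \<cdot> x" y] less.prems s mn assms(2,3)
          by (auto simp: subalgebra_def)
        moreover have "x \<cdot> (s \<cdot> y) \<in> lseries H S (m + n')"
          using less.hyps[of m n' x "s \<cdot> y"] less.prems s mn assms(2,3)
          by (auto simp: subalgebra_def)
        moreover have "m + n' = m' + n" using mn by simp
        ultimately show ?thesis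
          using left_leibniz[of s x y] subspace_add[OF subspace_lseries[OF assms(1)]] by simp
      qed
      then show ?thesis using mn by simp
    qed
  qed
  then show ?thesis using x y unfolding lnil_def by blast
qed

text \<open>For the least \<open>n\<close> such that \<open>V\<close> meets
  \<open>lseries H S n\<close> outside \<open>H\<close>, such an element is sent by \<open>S\<close>
  into the part of \<open>V\<close> in the preceding term, which lies in \<open>H\<close>.\<close>

lemma ex_new_annihilated:
  assumes V: "V \<subseteq> lnil H S" "\<not> V \<subseteq> H"
    and stable: "\<And>s v. s \<in> S \<Longrightarrow> v \<in> V \<Longrightarrow> s \<cdot> v \<in> V"
  obtains x where "x \<in> V" "x \<notin> H" "\<And>s. s \<in> S \<Longrightarrow> s \<cdot> x \<in> H"
proof -
  have ex: "\<exists>n. \<not> V \<inter> lseries H S n \<subseteq> H"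
    using V unfolding lnil_def by blast
  define n where "n = (LEAST n. \<not> V \<inter> lseries H S n \<subseteq> H)"
  have n: "\<not> V \<inter> lseries H S n \<subseteq> H" unfolding n_def by (rule LeastI_ex[OF ex])
  then obtain m where m: "n = Suc m" by (cases n) auto
  have "V \<inter> lseries H S m \<subseteq> H"
    using not_less_Least[of m "\<lambda>n. \<not> V \<inter> lseries H S n \<subseteq> H"] m n_def by auto
  then show thesis using n m that stable by auto blast
qed

text \<open>
  The symmetric products \<open>x \<cdot> s + s \<cdot> x\<close> annihilate everything from the left.  Hence either the
  elements \<open>y\<close> with \<open>y \<cdot> S \<subseteq> H\<close> already supply the required one, or they all lie in \<open>H\<close>
  and then \<open>s \<cdot> x \<in> H\<close> forces \<open>x \<cdot> s \<in> H\<close>.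
\<close>

lemma ex_new_biannihilated:
  assumes S: "subalgebra S" and H: "subspace H" and sub: "subspace V"
    and V: "V \<subseteq> lnil H S" "\<not> V \<subseteq> H"
    and SV: "\<And>s v. s \<in> S \<Longrightarrow> v \<in> V \<Longrightarrow> s \<cdot> v \<in> V"
    and VS: "\<And>s v. s \<in> S \<Longrightarrow> v \<in> V \<Longrightarrow> v \<cdot> s \<in> V"
    and SH: "\<And>s h. s \<in> S \<Longrightarrow> h \<in> H \<Longrightarrow> s \<cdot> h \<in> H"
  obtains x where "x \<in> V" "x \<notin> H" "\<And>s. s \<in> S \<Longrightarrow> s \<cdot> x \<in> H" "\<And>s. s \<in> S \<Longrightarrow> x \<cdot> s \<in> H"
proof -
  define U where "U = {y \<in> V. \<forall>s\<in>S. y \<cdot> s \<in> H}"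
  show thesis
  proof (cases "U \<subseteq> H")
    case True
    obtain x where x: "x \<in> V" "x \<notin> H" "\<And>s. s \<in> S \<Longrightarrow> s \<cdot> x \<in> H"
      using ex_new_annihilated[OF V SV] by blast
    have "x \<cdot> s \<in> H" if s: "s \<in> S" for s
    proof -
      have "x \<cdot> s + s \<cdot> x \<in> U"
        using x s sub SV VS subspace_add subspace_0[OF H] sym_product_annihilates
        by (simp add: U_def)
      then have "x \<cdot> s + s \<cdot> x - s \<cdot> x \<in> H"
        using True x s subspace_diff[OF H] by blast
      then show ?thesis by simp
    qed
    then show ?thesis using x that by blast
  next
    case False
    have "s \<cdot> u \<in> U" if "s \<in> S" "u \<in> U" for s u
      using that SV SH subalgebra_mult[OF S]
      by (auto simp: U_def left_leibniz' intro!: subspace_diff[OF H])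
    moreover have "U \<subseteq> lnil H S" using V by (auto simp: U_def)
    ultimately obtain x where "x \<in> U" "x \<notin> H" "\<And>s. s \<in> S \<Longrightarrow> s \<cdot> x \<in> H"
      using ex_new_annihilated[of U H S] False by blast
    then show ?thesis using that by (auto simp: U_def)
  qed
qed

text \<open>This is the normalizer condition: for \<open>M \<noteq> B\<close>, taking
  \<open>M\<close> both as \<open>S\<close> and as \<open>H\<close> in
  \<open>ex_new_biannihilated\<close> yields a normalizing element outside \<open>M\<close>.\<close>

lemma self_normalizing_eq:
  assumes "subalgebra M" "subalgebra B" "M \<subseteq> B" "self_normalizing M B" "B \<subseteq> lnil M M"
  shows "M = B"
proof (rule ccontr)
  assume "M \<noteq> B"
  then have "\<not> B \<subseteq> M" using assms(3) by blast
  then obtain x where "x \<in> B" "x \<notin> M"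
    "\<And>s. s \<in> M \<Longrightarrow> s \<cdot> x \<in> M" "\<And>s. s \<in> M \<Longrightarrow> x \<cdot> s \<in> M"
    by (rule ex_new_biannihilated[OF assms(1) assms(1,2)[THEN subalgebra_subspace] assms(5)])
      (use subalgebra_mult[OF assms(1)] subalgebra_mult[OF assms(2)] assms(3) in auto)
  then show False using assms(4) by (auto simp: self_normalizing_def normalizer_def)
qed

text \<open>Induction along the series of \<open>P\<close>: the summand in \<open>P\<close> lowers
  the term, and the summand in \<open>K\<close> leads to an element that \<open>m\<close> further
  multiplications by \<open>S\<close> kill, with \<open>m\<close> uniform.\<close>

lemma lnil_add_ideal:
  assumes S: "\<And>s. s \<in> S \<Longrightarrow> \<exists>p\<in>P. \<exists>k\<in>K. s = p + k"
    and PV: "\<And>p v. p \<in> P \<Longrightarrow> v \<in> V \<Longrightarrow> p \<cdot> v \<in> V"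
    and KV: "\<And>k v. k \<in> K \<Longrightarrow> v \<in> V \<Longrightarrow> k \<cdot> v \<in> lnil {0} S"
    and VP: "V \<subseteq> lnil {0} P"
  shows "V \<subseteq> lnil {0} S"
proof -
  obtain m where m: "lnil {0} S = lseries {0} S m"
    by (rule lnil_uniform[of "{0}" S]) (use that in auto)
  have sub: "subspace (lseries {0} S k)" for k by (rule subspace_lseries) simp
  have mono: "lseries {0} S m \<subseteq> lseries {0} S (m + n)" for n by (rule lseries_le) auto
  have "V \<inter> lseries {0} P n \<subseteq> lseries {0} S (m + n)" for n
  proof (induction n)
    case 0
    then show ?case using subspace_0[OF sub] by auto
  next
    case (Suc n)
    have "s \<cdot> x \<in> lseries {0} S (m + n)"
      if x: "x \<in> V" "x \<in> lseries {0} P (Suc n)" and s: "s \<in> S" for x s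
    proof -
      obtain p k where pk: "p \<in> P" "k \<in> K" "s = p + k" using S s by blast
      have "p \<cdot> x \<in> lseries {0} S (m + n)" using Suc pk x PV by auto
      moreover have "k \<cdot> x \<in> lseries {0} S (m + n)" using KV[OF pk(2) x(1)] m mono by auto
      ultimately show ?thesis using pk subspace_add[OF sub] by (simp add: mult_add_left)
    qed
    then show ?case by auto
  qed
  then show ?thesis using VP by (fastforce simp: lnil_def)
qed

subsection \<open>Nilpotency\<close>

text \<open>The lower central series descends while \<open>lseries\<close> ascends, so their terms
  are compared at complementary indices \<open>j\<close> and \<open>n - j\<close>.\<close>

lemma nilpotent_restrict_iff:
  assumes A: "subalgebra A"
  shows "nilpotent_algebra (restrict_algebra A) \<longleftrightarrow> A \<subseteq> lnil {0} A"
proof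
  let ?R = "restrict_algebra A"
  assume "nilpotent_algebra ?R"
  then obtain n where n: "lower_central ?R n = {0}"
    by (auto simp: nilpotent_algebra_def restrict_algebra_def)
  have "j \<le> n \<Longrightarrow> lower_central ?R (n - j) \<subseteq> lseries {0} A j" for j
  proof (induction j)
    case (Suc j)
    have "s \<cdot> x \<in> lower_central ?R (n - j)"
      if "s \<in> A" "x \<in> lower_central ?R (n - Suc j)" for s x
    proof -
      have eq: "n - j = Suc (n - Suc j)" using Suc.prems by simp
      show ?thesis unfolding eq using that
        by (auto simp: restrict_algebra_def intro!: lin_span_base)
    qed
    then show ?case using Suc by auto
  qed (use n in auto)
  from this[of n] show "A \<subseteq> lnil {0} A"
    by (auto simp: lnil_def restrict_algebra_def)
next
  let ?R = "restrict_algebra A"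
  assume "A \<subseteq> lnil {0} A"
  moreover obtain n where "lnil {0} A = lseries {0} A n"
    by (rule lnil_uniform[of "{0}" A]) (use that in auto)
  ultimately have n: "A \<subseteq> lseries {0} A n" by simp
  have sub: "subspace (lseries {0} A k)" for k by (rule subspace_lseries) simp
  have "j \<le> n \<Longrightarrow> lower_central ?R j \<subseteq> lseries {0} A (n - j)" for j
  proof (induction j)
    case 0
    then show ?case using n by (simp add: restrict_algebra_def)
  next
    case (Suc j)
    have eq: "n - j = Suc (n - Suc j)" using Suc.prems by simp
    have "x \<in> lseries {0} A (n - Suc j)"
      if "x \<in> lin_span ?R {mul ?R x y |x y. x \<in> carr ?R \<and> y \<in> lower_central ?R j}" for x
      using that
    proof induction
      case (lin_span_base x)
      then show ?case using Suc eq by (auto simp: restrict_algebra_def)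
    qed (use sub in \<open>auto simp: restrict_algebra_def subspace_def\<close>)
    then show ?case by auto
  qed
  from this[of n] have "lower_central ?R n \<subseteq> {0}" by simp
  moreover have "0 \<in> lower_central ?R n"
    using lin_span_zero[of ?R] subspace_0[OF subalgebra_subspace[OF A]]
    by (cases n) (simp_all add: restrict_algebra_def)
  ultimately show "nilpotent_algebra ?R"
    by (auto simp: nilpotent_algebra_def restrict_algebra_def intro!: exI[of _ n])
qed

text \<open>The same comparison at complementary indices, made on cosets. It translates nilpotent
  factors into \<open>lnil\<close>, so that later arguments stay inside the algebra.\<close>

lemma nilpotent_quotientD:
  assumes I: "is_ideal I" and J: "subalgebra J"
    and nil: "nilpotent_algebra (quotient_algebra J I)"
  shows "J \<subseteq> lnil I J"
proof -
  let ?Q = "quotient_algebra J I"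
  have sub: "subspace I" using I by (simp add: is_ideal_def)
  have carr: "carr ?Q = coset I ` J" and zer: "zer ?Q = I"
    by (simp_all add: quotient_algebra_def)
  obtain n where n: "lower_central ?Q n = {I}"
    using nil by (auto simp: nilpotent_algebra_def zer)
  have "j \<le> n \<Longrightarrow> x \<in> J \<Longrightarrow> coset I x \<in> lower_central ?Q (n - j) \<Longrightarrow> x \<in> lseries I J j" for j x
  proof (induction j arbitrary: x)
    case 0
    then show ?case using n coset_self[OF sub, of x] by auto
  next
    case (Suc j)
    have eq: "n - j = Suc (n - Suc j)" using Suc.prems by simp
    have "y \<cdot> x \<in> lseries I J j" if y: "y \<in> J" for y
    proof -
      have "mul ?Q (coset I y) (coset I x) \<in> lower_central ?Q (n - j)"
        unfolding eq lower_central.simps(2) carr using y Suc.prems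
        by (blast intro: lin_span_base)
      then have "coset I (y \<cdot> x) \<in> lower_central ?Q (n - j)"
        by (simp add: quotient_mul_coset[OF I])
      then show ?thesis
        using Suc y subalgebra_mult[OF J] by auto
    qed
    then show ?case by simp
  qed
  from this[of n] show ?thesis by (auto simp: lnil_def carr)
qed

section \<open>Sums of subspaces and stability of the series\<close>

definition vsum :: "'v set \<Rightarrow> 'v set \<Rightarrow> 'v set" where
  "vsum A T = {x + y |x y. x \<in> A \<and> y \<in> T}"

lemma vsumI: "x \<in> A \<Longrightarrow> y \<in> T \<Longrightarrow> x + y \<in> vsum A T"
  by (auto simp: vsum_def)

lemma subset_vsum:
  assumes "subspace A" "subspace T"
  shows "A \<subseteq> vsum A T" "T \<subseteq> vsum A T"
  using vsumI[of _ A 0 T] vsumI[of 0 A _ T] subspace_0 assms by auto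

lemma vsum_subset: "subspace B \<Longrightarrow> A \<subseteq> B \<Longrightarrow> T \<subseteq> B \<Longrightarrow> vsum A T \<subseteq> B"
  by (auto simp: vsum_def intro: subspace_add)

lemma subspace_vsum: "subspace A \<Longrightarrow> subspace T \<Longrightarrow> subspace (vsum A T)"
  unfolding vsum_def by (rule subspace_sums)

lemma subalgebra_vsum:
  assumes A: "subalgebra A" and T: "subspace T"
    and "\<And>a t. a \<in> A \<Longrightarrow> t \<in> T \<Longrightarrow> a \<cdot> t \<in> vsum A T \<and> t \<cdot> a \<in> vsum A T"
    and "\<And>t u. t \<in> T \<Longrightarrow> u \<in> T \<Longrightarrow> t \<cdot> u \<in> vsum A T"
  shows "subalgebra (vsum A T)"
proof -
  note sub = subalgebra_subspace[OF A]
  note subs = subspace_vsum[OF sub T]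
  have "(a + t) \<cdot> (b + u) \<in> vsum A T" if "a \<in> A" "t \<in> T" "b \<in> A" "u \<in> T" for a t b u
    using that assms(3,4) subalgebra_mult[OF A] subset_vsum[OF sub T]
    by (auto simp: mult_add_left mult_add_right intro!: subspace_add[OF subs])
  then show ?thesis using subs by (auto simp: subalgebra_def vsum_def)
qed

lemma lnil_vsum:
  assumes "\<And>p v. p \<in> P \<Longrightarrow> v \<in> V \<Longrightarrow> p \<cdot> v \<in> V"
    and "\<And>k v. k \<in> K \<Longrightarrow> v \<in> V \<Longrightarrow> k \<cdot> v \<in> lnil {0} (vsum P K)"
    and "V \<subseteq> lnil {0} P"
  shows "V \<subseteq> lnil {0} (vsum P K)"
  by (rule lnil_add_ideal[OF _ assms]) (auto simp: vsum_def)

text \<open>In \<open>s \<cdot> (x \<cdot> v) = (s \<cdot> x) \<cdot> v + x \<cdot> (s \<cdot>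
  v)\<close> the factor \<open>s \<cdot> x\<close> is again in \<open>S\<close>, which settles the
  first summand; induction settles the second.\<close>

lemma lseries_stable:
  assumes "\<And>s. s \<in> S \<Longrightarrow> s \<cdot> x \<in> S" and "subspace H" and "\<And>h. h \<in> H \<Longrightarrow> x \<cdot> h \<in> H"
  shows "v \<in> lseries H S n \<Longrightarrow> x \<cdot> v \<in> lseries H S n"
proof (induction n arbitrary: v)
  case (Suc n)
  have "s \<cdot> (x \<cdot> v) \<in> lseries H S n" if "s \<in> S" for s
    using that Suc assms(1) unfolding left_leibniz[of s x v]
    by (auto intro!: subspace_add[OF subspace_lseries[OF assms(2)]])
  then show ?case by simp
qed (use assms in auto)

section \<open>Engel's theorem, the Fitting decomposition, and nilpotency of the elements of
  \<open>M_set\<close>\<close>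

lemma lnil_span_singleton:
  assumes "subspace H"
  shows "lnil H (span {x}) = lnil H {x}"
proof -
  have "lseries H (span {x}) n = lseries H {x} n" for n
  proof (induction n)
    case (Suc n)
    then have "lseries H (span {x}) (Suc n) = {v. \<forall>c. scale c (x \<cdot> v) \<in> lseries H {x} n}"
      by (auto simp: span_singleton mult_scale_left)
    also have "\<dots> = {v. x \<cdot> v \<in> lseries H {x} n}"
      using subspace_scale[OF subspace_lseries[OF assms]] scale_one by metis
    finally show ?case by simp
  qed simp
  then show ?thesis by (simp add: lnil_def)
qed

text \<open>A subalgebra \<open>T\<close> maximal among those acting nilpotently on \<open>S\<close>
  must be \<open>S\<close>: otherwise an element \<open>x\<close> outside \<open>T\<close>
  normalizes \<open>T\<close>, and \<open>T\<close> can be enlarged by \<open>x\<close>.\<close>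

theorem engel:
  assumes S: "subalgebra S" and nil: "\<And>s. s \<in> S \<Longrightarrow> S \<subseteq> lnil {0} {s}"
  shows "S \<subseteq> lnil {0} S"
proof -
  note subS = subalgebra_subspace[OF S]
  let ?P = "\<lambda>T. subalgebra T \<and> T \<subseteq> S \<and> S \<subseteq> lnil {0} T"
  have "?P {0}"
    using subspace_0[OF subS] by (auto simp: subalgebra_def lnil_def intro!: exI[of _ 1])
  then obtain T where T: "?P T" and maxT: "\<And>T'. ?P T' \<Longrightarrow> T \<subseteq> T' \<Longrightarrow> T' = T"
    by (rule ex_maximal_subspace[of ?P]) (use subalgebra_subspace in auto)
  have subT: "subspace T" using T subalgebra_subspace by blast
  \<comment> \<open>The left annihilator \<open>U\<close> acts as zero on \<open>S\<close>, so
    adding it to \<open>T\<close> keeps the action nilpotent; maximality then puts \<open>U\<close>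
    inside \<open>T\<close>.\<close>
  define U where "U = {y \<in> S. \<forall>z\<in>S. y \<cdot> z = 0}"
  have subU: "subspace U"
    using subS by (auto simp: U_def subspace_def mult_add_left mult_scale_left)
  have U_left: "s \<cdot> u \<in> U" if "s \<in> S" "u \<in> U" for s u
    using that subalgebra_mult[OF S] by (auto simp: U_def left_leibniz')
  have U_right: "u \<cdot> s = 0" if "s \<in> S" "u \<in> U" for s u
    using that by (auto simp: U_def)
  have "subalgebra (vsum T U)"
  proof (rule subalgebra_vsum)
    show "a \<cdot> t \<in> vsum T U \<and> t \<cdot> a \<in> vsum T U" if "a \<in> T" "t \<in> U" for a t
      using that T U_left[of a t] U_right[of a t] subset_vsum(2)[OF subT subU]
        subspace_0[OF subspace_vsum[OF subT subU]]
      by auto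
    show "t \<cdot> u \<in> vsum T U" if "t \<in> U" "u \<in> U" for t u
      using that U_right[of t u] U_right[of u t] subspace_0[OF subspace_vsum[OF subT subU]]
      by (auto simp: U_def)
  qed (use T subU in auto)
  moreover have "vsum T U \<subseteq> S" by (rule vsum_subset[OF subS]) (use T in \<open>auto simp: U_def\<close>)
  moreover have "S \<subseteq> lnil {0} (vsum T U)"
  proof (rule lnil_vsum)
    show "k \<cdot> v \<in> lnil {0} (vsum T U)" if "k \<in> U" "v \<in> S" for k v
      using that U_right subspace_0[OF subspace_lnil[of "{0}"]] by simp
  qed (use T subalgebra_mult[OF S] in auto)
  ultimately have UT: "U \<subseteq> T"
    using maxT[of "vsum T U"] subset_vsum[OF subT subU] by auto
  have "S \<subseteq> T"
  proof (rule ccontr)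
    assume notST: "\<not> S \<subseteq> T"
    have "S \<subseteq> lnil T T"
      using T lnil_mono[of "{0}" T T T] subspace_0[OF subT] by auto
    then obtain x where x: "x \<in> S" "x \<notin> T"
      and xT: "\<And>s. s \<in> T \<Longrightarrow> s \<cdot> x \<in> T" "\<And>s. s \<in> T \<Longrightarrow> x \<cdot> s \<in> T"
      by (rule ex_new_biannihilated[OF conjunct1[OF T] subT subS _ notST])
        (use T subalgebra_mult[OF S] subalgebra_mult[of T] in auto)
    \<comment> \<open>Squares need not vanish, but they annihilate from the left. This is what
      closes \<open>T\<close> plus the span of \<open>x\<close> under products.\<close>
    have "x \<cdot> x \<in> U"
      using x subalgebra_mult[OF S] by (auto simp: U_def left_leibniz')
    then have xx: "x \<cdot> x \<in> T" using UT by blast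
    let ?X = "span {x}"
    have subX: "subspace ?X" by simp
    have XT: "t \<cdot> u \<in> T \<and> u \<cdot> t \<in> T" if "t \<in> ?X" "u \<in> T" for t u
      using that xT subspace_scale[OF subT]
      by (auto simp: span_singleton mult_scale_left mult_scale_right)
    have XX: "t \<cdot> u \<in> T" if "t \<in> ?X" "u \<in> ?X" for t u
      using that xx subspace_scale[OF subT]
      by (auto simp: span_singleton mult_scale_left mult_scale_right)
    have XS: "?X \<subseteq> S" using x subS by (simp add: span_minimal)
    note sub_X = subset_vsum[OF subX subT]
    \<comment> \<open>\<open>subalgebra_vsum\<close> takes the subalgebra \<open>T\<close> as first
      summand, while \<open>lnil_vsum\<close> takes there the part that preserves the terms of the
      series, namely the span of \<open>x\<close>.\<close>
    have sumX: "vsum ?X T = vsum T ?X" by (auto simp: vsum_def) (metis add.commute)+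
    have "subalgebra (vsum T ?X)"
    proof (rule subalgebra_vsum)
      show "a \<cdot> t \<in> vsum T ?X \<and> t \<cdot> a \<in> vsum T ?X" if "a \<in> T" "t \<in> ?X" for a t
        using that XT sub_X sumX by blast
      show "t \<cdot> u \<in> vsum T ?X" if "t \<in> ?X" "u \<in> ?X" for t u
        using that XX sub_X sumX by blast
    qed (use T subX in auto)
    moreover have "vsum T ?X \<subseteq> S" by (rule vsum_subset[OF subS]) (use T XS in auto)
    moreover have "S \<subseteq> lnil {0} (vsum ?X T)"
    proof -
      \<comment> \<open>Each term of the series of \<open>T\<close> is preserved by
        \<open>x\<close>, which acts nilpotently on it, while \<open>T\<close> maps it into the
        preceding term.\<close>
      have "S \<inter> lseries {0} T j \<subseteq> lnil {0} (vsum ?X T)" for j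
      proof (induction j)
        case 0
        then show ?case using subspace_0[OF subspace_lnil[of "{0}"]] by auto
      next
        case (Suc j)
        show ?case
        proof (rule lnil_vsum)
          show "p \<cdot> v \<in> S \<inter> lseries {0} T (Suc j)"
            if "p \<in> ?X" "v \<in> S \<inter> lseries {0} T (Suc j)" for p v
            using that XS XT subalgebra_mult[OF S]
              lseries_stable[of T p "{0}" v "Suc j"] by auto
          show "k \<cdot> v \<in> lnil {0} (vsum ?X T)"
            if "k \<in> T" "v \<in> S \<inter> lseries {0} T (Suc j)" for k v
          proof -
            have "k \<cdot> v \<in> S \<inter> lseries {0} T j"
              using that T subalgebra_mult[OF S] by auto
            then show ?thesis using Suc by blast
          qed
          show "S \<inter> lseries {0} T (Suc j) \<subseteq> lnil {0} ?X"
            using nil[OF x(1)] by (auto simp: lnil_span_singleton)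
        qed
      qed
      then have "S \<inter> lnil {0} T \<subseteq> lnil {0} (vsum ?X T)" by (auto simp: lnil_def[of "{0}" T])
      then show ?thesis using T by blast
    qed
    ultimately have "vsum T ?X = T"
      using maxT[of "vsum T ?X"] sub_X sumX by simp
    then show False using x sub_X sumX span_base[of x "{x}"] by auto
  qed
  then show ?thesis using T by auto
qed

text \<open>The images of \<open>V\<close> under powers of left multiplication by \<open>a\<close>
  decrease and become stationary. So \<open>f n x = f (Suc n) y\<close> for some \<open>n\<close>
  and \<open>y\<close>, and \<open>f n\<close> kills \<open>x - a \<cdot> y\<close>.\<close>

lemma fitting:
  assumes V: "subspace V" and stable: "\<And>v. v \<in> V \<Longrightarrow> a \<cdot> v \<in> V" and x: "x \<in> V"
  obtains y where "y \<in> V" "x - a \<cdot> y \<in> lnil {0} {a}"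
proof -
  define f where "f n = (((\<cdot>) a) ^^ n)" for n
  have f_Suc: "f (Suc n) v = a \<cdot> f n v" "f (Suc n) v = f n (a \<cdot> v)" for n v
    by (simp_all add: f_def funpow_swap1)
  have f_diff: "f n (v - w) = f n v - f n w" for n v w
    by (induction n) (simp_all add: f_def mult_diff_right)
  have f_lseries: "lseries {0} {a} n = {v. f n v = 0}" for n
    by (induction n) (auto simp: f_def funpow_swap1)
  have sub: "subspace (f n ` V)" for n
  proof (induction n)
    case 0
    then show ?case using V by (simp add: f_def)
  next
    case (Suc n)
    have "f (Suc n) ` V = (\<cdot>) a ` f n ` V" by (auto simp: f_Suc(1))
    also have "subspace \<dots>"
      using Suc unfolding subspace_def
      by (auto simp: image_iff) (metis mult_zero_right mult_add_right mult_scale_right)+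
    finally show ?case .
  qed
  obtain W where "\<exists>n. W = f n ` V"
    and W: "\<And>W'. \<exists>n. W' = f n ` V \<Longrightarrow> W' \<subseteq> W \<Longrightarrow> W' = W"
    by (rule ex_minimal_subspace[of "\<lambda>W. \<exists>n. W = f n ` V" "f 0 ` V"]) (use sub in blast)+
  then obtain n where n: "\<And>m. f m ` V \<subseteq> f n ` V \<Longrightarrow> f m ` V = f n ` V"
    by metis
  have "f (Suc n) ` V = f n ` V"
    by (rule n) (use stable in \<open>auto simp: f_Suc(2)\<close>)
  then obtain y where y: "y \<in> V" "f n x = f (Suc n) y" using x by blast
  then have "x - a \<cdot> y \<in> lseries {0} {a} n"
    by (simp add: f_lseries f_diff f_Suc(2))
  then show thesis using y that unfolding lnil_def by blast
qed

lemma normalizer_eq: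
  assumes M: "maximal_subalgebra M B" and C: "subspace C" and MN: "M \<subseteq> normalizer B C"
    and x: "x \<in> normalizer B C" "x \<notin> M"
  shows "normalizer B C = B"
  using maximal_subalgebraD(5)[OF M subalgebra_normalizer[OF _ C] MN] maximal_subalgebraD(2)[OF M] x
  by (auto simp: normalizer_def)

text \<open>
  If left multiplication by \<open>a\<close> is not nilpotent, its Fitting null component lies in a maximal
  subalgebra \<open>M\<close>, which is self-normalizing.  In a Leibniz algebra \<open>a\<close> need not lie in its own
  null component; subtracting a left annihilator \<open>y\<close> from \<open>a\<close> achieves this.
\<close>

theorem nilpotent_if_no_self_normalizing_maximal:
  assumes A: "subalgebra A"
    and no: "\<not> (\<exists>B. maximal_subalgebra B A \<and> self_normalizing B A)"
  shows "A \<subseteq> lnil {0} A"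
proof (rule engel[OF A], rule ccontr)
  fix a assume a: "a \<in> A" and not_nil: "\<not> A \<subseteq> lnil {0} {a}"
  note subA = subalgebra_subspace[OF A]
  define U where "U = {y \<in> A. \<forall>z\<in>A. y \<cdot> z = 0}"
  have subU: "subspace U"
    using subA by (auto simp: U_def subspace_def mult_add_left mult_scale_left)
  have "a \<cdot> u \<in> U" if "u \<in> U" for u
    using that a subalgebra_mult[OF A] by (auto simp: U_def left_leibniz')
  moreover have "a \<cdot> a \<in> U"
    using a subalgebra_mult[OF A] by (auto simp: U_def left_leibniz')
  \<comment> \<open>The Fitting decomposition is applied inside \<open>U\<close>, which is stable
    under \<open>a\<close> and contains \<open>a \<cdot> a\<close>. It makes
    \<open>a \<cdot> (a - y)\<close>, and hence \<open>a - y\<close>, nil under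
    \<open>a\<close>.\<close>
  ultimately obtain y where y: "y \<in> U" "a \<cdot> a - a \<cdot> y \<in> lnil {0} {a}"
    using fitting[OF subU] by blast
  obtain n where "a \<cdot> (a - y) \<in> lseries {0} {a} n"
    using y(2) unfolding lnil_def mult_diff_right by blast
  then have "a - y \<in> lseries {0} {a} (Suc n)" by simp
  then have nil: "a - y \<in> lnil {0} {a}" unfolding lnil_def by blast
  define H where "H = A \<inter> lnil {0} {a}"
  have aH: "a - y \<in> H" using nil a y subA by (auto simp: H_def U_def intro: subspace_diff)
  have same: "(a - y) \<cdot> z = a \<cdot> z" if "z \<in> A" for z
    using y that by (simp add: mult_diff_left U_def)
  have H: "subalgebra H"
    unfolding subalgebra_def H_def
    using subA subspace_lnil[of "{0}" "{a}"] subalgebra_mult[OF A] a A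
    by (auto intro!: subspace_inter lnil_mult[of "{0}" A])
  let ?P = "\<lambda>M. subalgebra M \<and> H \<subseteq> M \<and> M \<subset> A"
  have "?P H" using H not_nil by (auto simp: H_def)
  then obtain M where M: "?P M" and maxM: "\<And>M'. ?P M' \<Longrightarrow> M \<subseteq> M' \<Longrightarrow> M' = M"
    by (rule ex_maximal_subspace[of ?P]) (use subalgebra_subspace in auto)
  have mM: "maximal_subalgebra M A"
  proof -
    have "D = M" if "subalgebra D" "M \<subset> D" "D \<subset> A" for D
      using maxM[of D] that M by auto
    then show ?thesis using M A by (auto simp: maximal_subalgebra_def)
  qed
  have MN: "M \<subseteq> normalizer A M" using M subalgebra_mult by (auto simp: normalizer_def)
  have "\<not> self_normalizing M A" using no mM by blast
  then obtain x where "x \<in> normalizer A M" "x \<notin> M"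
    using MN by (auto simp: self_normalizing_def)
  then have N: "normalizer A M = A"
    using normalizer_eq[OF mM _ MN] M subalgebra_subspace by blast
  \<comment> \<open>\<open>M\<close> is now an ideal of \<open>A\<close> containing
    \<open>a - y\<close>, so it contains \<open>a \<cdot> A\<close>; together with \<open>H\<close>
    this spans \<open>A\<close>.\<close>
  have "x \<in> M" if x: "x \<in> A" for x
  proof -
    obtain z where z: "z \<in> A" "x - a \<cdot> z \<in> lnil {0} {a}"
      using fitting[OF subA _ x] a subalgebra_mult[OF A] by blast
    have "x - a \<cdot> z \<in> H"
      using z(2) subspace_diff[OF subA x subalgebra_mult[OF A a z(1)]] by (simp add: H_def)
    then have "x - a \<cdot> z \<in> M" using M by blast
    moreover have "a \<cdot> z \<in> M"
    proof -
      have "z \<in> normalizer A M" "a - y \<in> M" using N z(1) aH M by auto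
      then have "(a - y) \<cdot> z \<in> M" by (simp add: normalizer_def)
      then show ?thesis using same[OF z(1)] by simp
    qed
    ultimately have "x - a \<cdot> z + a \<cdot> z \<in> M"
      using M subalgebra_subspace subspace_add by blast
    then show ?thesis by simp
  qed
  then show False using M by blast
qed

subsection \<open>Chains of maximal self-normalizing subalgebras\<close>

lemma is_idealD:
  assumes "is_ideal I"
  shows "subspace I" "subalgebra I" "\<And>x y. y \<in> I \<Longrightarrow> x \<cdot> y \<in> I" "\<And>x y. y \<in> I \<Longrightarrow> y \<cdot> x \<in> I"
  using assms by (auto simp: is_ideal_def subalgebra_def)

lemma maximal_vsum_ideal:
  assumes M: "maximal_subalgebra M B" and T: "subspace T" "T \<subseteq> B"
    and ideal: "\<And>b t. b \<in> B \<Longrightarrow> t \<in> T \<Longrightarrow> b \<cdot> t \<in> T \<and> t \<cdot> b \<in> T"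
  shows "T \<subseteq> M \<or> vsum M T = B"
proof -
  note D = maximal_subalgebraD[OF M]
  note sub = subset_vsum[OF subalgebra_subspace[OF D(1)] T(1)]
  have "subalgebra (vsum M T)"
    by (rule subalgebra_vsum[OF D(1) T(1)])
      (use ideal subsetD[OF D(3)] subsetD[OF T(2)] subsetD[OF sub(2)] in blast)+
  moreover have "vsum M T \<subseteq> B"
    by (rule vsum_subset[OF subalgebra_subspace[OF D(2)] D(3) T(2)])
  ultimately show ?thesis using D(5)[of "vsum M T"] sub by auto
qed

lemma maximal_ideal_cases:
  assumes M: "maximal_subalgebra M B" and J: "is_ideal J"
  shows "J \<inter> B \<subseteq> M \<or> vsum M (J \<inter> B) = B"
proof -
  note B = maximal_subalgebraD(2)[OF M]
  show ?thesis
    by (rule maximal_vsum_ideal[OF M subspace_inter[OF is_idealD(1)[OF J] subalgebra_subspace[OF B]]])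
      (use is_idealD(3,4)[OF J] subalgebra_mult[OF B] in auto)
qed

text \<open>If \<open>J \<inter> B\<close> were inside \<open>M\<close>, nilpotency modulo
  \<open>J\<close> would make \<open>M\<close> act nilpotently on \<open>B\<close> modulo
  \<open>M\<close>, against \<open>self_normalizing_eq\<close>.\<close>

lemma self_normalizing_vsum_ideal:
  assumes M: "maximal_subalgebra M B" "self_normalizing M B"
    and J: "is_ideal J" "UNIV \<subseteq> lnil J UNIV"
  shows "vsum M (J \<inter> B) = B"
proof (rule ccontr)
  note D = maximal_subalgebraD[OF M(1)]
  assume "\<not> ?thesis"
  then have "J \<inter> B \<subseteq> M" using maximal_ideal_cases[OF M(1) J(1)] by blast
  moreover have "B \<inter> lnil J B \<subseteq> lnil (J \<inter> B) B"
    by (rule lnil_relative) (use D subalgebra_mult in blast)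
  moreover have "lnil J UNIV \<subseteq> lnil J B" by (rule lnil_mono) auto
  moreover have "lnil (J \<inter> B) B \<subseteq> lnil M M" if "J \<inter> B \<subseteq> M"
    by (rule lnil_mono) (use D that in auto)
  ultimately have "B \<subseteq> lnil M M" using J(2) by blast
  then show False using self_normalizing_eq[of M B] D M(2) by blast
qed

lemma vsum_elim:
  assumes "x \<in> vsum M T"
  obtains m t where "m \<in> M" "t \<in> T" "x = m + t"
  using assms by (auto simp: vsum_def)

text \<open>
  With \<open>K = J \<inter> B\<close> and \<open>H = K \<inter> M\<close>, both \<open>H\<close> is an ideal of \<open>B\<close> and \<open>K \<cdot> K \<subseteq> H\<close>.
  If some element of \<open>K\<close> outside \<open>H\<close> were \<open>A\<close>-nilpotent modulo \<open>H\<close>, there would be one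
  annihilated modulo \<open>H\<close> by \<open>A\<close> and by \<open>K\<close> on both sides, hence normalizing \<open>M\<close>.
\<close>

lemma lnil_subset_maximal:
  assumes M: "maximal_subalgebra M B" "self_normalizing M B"
    and I: "is_ideal I" and J: "is_ideal J" "J \<subseteq> lnil I J"
    and A: "subalgebra A" "A \<subseteq> M" "A \<subseteq> lnil {0} A"
    and BA: "B \<subseteq> vsum A J" and IM: "I \<inter> B \<subseteq> M" and IJ: "I \<subseteq> J"
  shows "B \<inter> lnil I A \<subseteq> M"
proof -
  note D = maximal_subalgebraD[OF M(1)]
  note subB = subalgebra_subspace[OF D(2)] and subM = subalgebra_subspace[OF D(1)]
  note multB = subalgebra_mult[OF D(2)] and multM = subalgebra_mult[OF D(1)]
  define K where "K = J \<inter> B"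
  define H where "H = K \<inter> M"
  have subK: "subspace K" and subH: "subspace H"
    using is_idealD(1)[OF J(1)] subB subM by (simp_all add: K_def H_def subspace_inter)
  have K_ideal: "b \<cdot> k \<in> K" "k \<cdot> b \<in> K" if "b \<in> B" "k \<in> K" for b k
    using that is_idealD(3,4)[OF J(1)] multB by (auto simp: K_def)
  have KB: "K \<subseteq> B" and HK: "H \<subseteq> K" by (auto simp: K_def H_def)
  have IH: "I \<inter> B \<subseteq> H" using IM IJ by (auto simp: K_def H_def)
  have K_alg: "subalgebra K" and H_alg: "subalgebra H"
    using subK subH K_ideal KB multM by (auto simp: subalgebra_def H_def)
  have H_stable: "m \<cdot> h \<in> H \<and> h \<cdot> m \<in> H" if "m \<in> M" "h \<in> H" for m h
    using that K_ideal D(3) multM by (auto simp: H_def)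
  have K_nil: "K \<subseteq> lnil H K"
  proof -
    have "B \<inter> lnil I K \<subseteq> lnil (I \<inter> B) K"
      by (rule lnil_relative) (use KB multB in blast)
    moreover have "lnil I J \<subseteq> lnil I K" by (rule lnil_mono) (auto simp: K_def)
    moreover have "lnil (I \<inter> B) K \<subseteq> lnil H K" by (rule lnil_mono) (use IH in auto)
    ultimately show ?thesis using J(2) KB by (auto simp: K_def)
  qed
  \<comment> \<open>The modular law:
    \<open>K \<inter> (M + T) = (K \<inter> M) + T = T\<close>.\<close>
  have K_split: "K \<subseteq> T" if "vsum M T = B" "H \<subseteq> T" "T \<subseteq> K" "subspace T" for T
  proof
    fix k assume k: "k \<in> K"
    then have "k \<in> vsum M T" using that(1) KB by auto
    then obtain m t where mt: "m \<in> M" "t \<in> T" "k = m + t" by (rule vsum_elim)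
    have "k - t \<in> K" using mt(2) k that(3) by (auto intro: subspace_diff[OF subK])
    then have "m \<in> T" using mt that(2) by (auto simp: H_def)
    then show "k \<in> T" unfolding mt(3) using mt(2) by (rule subspace_add[OF that(4)])
  qed
  \<comment> \<open>Unless \<open>K = H\<close>, the normalizer condition inside \<open>K\<close>
    gives an element outside \<open>M\<close> normalizing \<open>H\<close>. As \<open>M\<close>
    normalizes \<open>H\<close> too, maximality extends this to all of \<open>B\<close>.\<close>
  have H_ideal: "b \<cdot> h \<in> H \<and> h \<cdot> b \<in> H" if "b \<in> B" "h \<in> H" for b h
  proof (cases "K \<subseteq> H")
    case True
    then show ?thesis using that K_ideal HK by blast
  next
    case False
    have "K \<subseteq> lnil H H" using K_nil lnil_mono[of H H H K] HK by blast
    then obtain x where x: "x \<in> K" "x \<notin> H"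
      and "\<And>s. s \<in> H \<Longrightarrow> s \<cdot> x \<in> H" "\<And>s. s \<in> H \<Longrightarrow> x \<cdot> s \<in> H"
      by (rule ex_new_biannihilated[OF H_alg subH subK _ False])
        (use subsetD[OF HK] subsetD[OF KB] K_ideal subalgebra_mult[OF H_alg] in blast)+
    then have "x \<in> normalizer B H" "x \<notin> M"
      using KB by (auto simp: normalizer_def H_def)
    moreover have "M \<subseteq> normalizer B H"
      using H_stable D(3) by (auto simp: normalizer_def)
    ultimately have "normalizer B H = B" using normalizer_eq[OF M(1) subH] by blast
    then show ?thesis using that by (auto simp: normalizer_def)
  qed
  have KK: "k \<cdot> l \<in> H" if kl: "k \<in> K" "l \<in> K" for k l
  proof (cases "K \<subseteq> H")
    case True
    then show ?thesis using that K_ideal KB by blast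
  next
    case False
    \<comment> \<open>The two-sided annihilator of \<open>K\<close> modulo \<open>H\<close>. It is
      an ideal of \<open>B\<close> not inside \<open>M\<close>, so \<open>M + T = B\<close>, and
      \<open>K_split\<close> gives \<open>K \<subseteq> T\<close>.\<close>
    define T where "T = {x \<in> K. \<forall>k\<in>K. k \<cdot> x \<in> H \<and> x \<cdot> k \<in> H}"
    have subT: "subspace T"
      using subK subH by (auto simp: T_def subspace_def mult_add_left mult_add_right
          mult_scale_left mult_scale_right)
    have "b \<cdot> t \<in> T \<and> t \<cdot> b \<in> T" if b: "b \<in> B" and t: "t \<in> T" for b t
    proof -
      have "k \<cdot> (b \<cdot> t) \<in> H" "(b \<cdot> t) \<cdot> k \<in> H" "k \<cdot> (t \<cdot> b) \<in> H" "(t \<cdot> b) \<cdot> k \<in> H"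
        if k: "k \<in> K" for k
        using b t k K_ideal H_ideal subspace_add[OF subH] subspace_diff[OF subH]
        unfolding left_leibniz[of k] left_leibniz'[of _ _ k] by (auto simp: T_def)
      then show ?thesis using b t K_ideal by (auto simp: T_def)
    qed
    moreover have "\<not> T \<subseteq> M"
    proof -
      obtain x where "x \<in> K" "x \<notin> H" "\<And>s. s \<in> K \<Longrightarrow> s \<cdot> x \<in> H" "\<And>s. s \<in> K \<Longrightarrow> x \<cdot> s \<in> H"
        by (rule ex_new_biannihilated[OF K_alg subH subK K_nil False])
          (use subsetD[OF KB] K_ideal H_ideal in blast)+
      then show ?thesis by (auto simp: T_def H_def)
    qed
    moreover have "T \<subseteq> B" using KB by (auto simp: T_def)
    ultimately have "vsum M T = B"
      using maximal_vsum_ideal[OF M(1) subT] by blast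
    then have "K \<subseteq> T"
      by (rule K_split) (use HK H_ideal KB subT in \<open>auto simp: T_def\<close>)
    then show ?thesis using that by (auto simp: T_def)
  qed
  have AB: "A \<subseteq> B" using A(2) D(3) by blast
  have sub_lnil: "subspace (lnil H A)"
    by (rule subspace_lnil[OF subH]) (use H_stable A(2) in blast)
  have split: "\<exists>a\<in>A. \<exists>k\<in>K. b = a + k" if b: "b \<in> B" for b
  proof -
    have "b \<in> vsum A J" using BA b by auto
    then obtain a j where aj: "a \<in> A" "j \<in> J" "b = a + j" by (rule vsum_elim)
    have "b - a \<in> B" using b aj(1) AB by (auto intro: subspace_diff[OF subB])
    then have "j \<in> K" using aj by (simp add: K_def)
    then show ?thesis using aj by blast
  qed
  define V where "V = K \<inter> lnil H A"
  have A_nil: "A \<subseteq> lnil H A"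
    using A(3) lnil_mono[of "{0}" H A A] subspace_0[OF subH] by auto
  have VH: "V \<subseteq> H"
  proof (rule ccontr)
    assume notVH: "\<not> V \<subseteq> H"
    have subV: "subspace V" unfolding V_def by (intro subspace_inter subK sub_lnil)
    have AV: "a \<cdot> v \<in> V \<and> v \<cdot> a \<in> V" if "a \<in> A" "v \<in> V" for a v
    proof -
      have "a \<in> B \<inter> lnil H A" "v \<in> B \<inter> lnil H A" using that AB KB A_nil by (auto simp: V_def)
      then have "a \<cdot> v \<in> lnil H A" "v \<cdot> a \<in> lnil H A"
        using lnil_mult[OF subH D(2) AB H_ideal] by auto
      then show ?thesis using that K_ideal AB by (auto simp: V_def)
    qed
    have "V \<subseteq> lnil H A" by (simp add: V_def)
    then obtain x where x: "x \<in> V" "x \<notin> H"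
      and xA: "\<And>s. s \<in> A \<Longrightarrow> s \<cdot> x \<in> H" "\<And>s. s \<in> A \<Longrightarrow> x \<cdot> s \<in> H"
      by (rule ex_new_biannihilated[OF A(1) subH subV _ notVH])
        (use AV H_stable subsetD[OF A(2)] in blast)+
    have xK: "x \<in> K" using x by (simp add: V_def)
    \<comment> \<open>Since \<open>B = A + K\<close>, products with \<open>A\<close> are covered by
      the choice of \<open>x\<close> and products with \<open>K\<close> by
      \<open>KK\<close>.\<close>
    have "x \<cdot> b \<in> H \<and> b \<cdot> x \<in> H" if "b \<in> B" for b
      using split[OF that] xA KK xK
      by (auto simp: mult_add_left mult_add_right intro!: subspace_add[OF subH])
    then have "x \<in> normalizer B M"
      using xK KB D(3) by (auto simp: normalizer_def H_def)
    then show False using M(2) x xK by (auto simp: self_normalizing_def H_def)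
  qed
  show ?thesis
  proof
    fix x assume x: "x \<in> B \<inter> lnil I A"
    have "B \<inter> lnil I A \<subseteq> lnil (I \<inter> B) A"
      by (rule lnil_relative) (use AB multB in blast)
    also have "\<dots> \<subseteq> lnil H A" by (rule lnil_mono) (use IH in auto)
    finally have xn: "x \<in> lnil H A" using x by blast
    obtain a k where ak: "a \<in> A" "k \<in> K" "x = a + k" using split x by blast
    have "x - a \<in> lnil H A" using ak(1) xn A_nil by (auto intro: subspace_diff[OF sub_lnil])
    then have "k \<in> V" using ak by (simp add: V_def)
    then have "k \<in> M" using VH by (auto simp: H_def)
    then show "x \<in> M" using ak A(2) subspace_add[OF subM] by auto
  qed
qed

text \<open>Going up the chain, only elements of \<open>I\<close> are added to the nil part: if
  \<open>I \<inter> C (Suc i) \<subseteq> C i\<close>, nothing is added by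
  \<open>lnil_subset_maximal\<close>; otherwise \<open>C (Suc i)\<close> is the sum of
  \<open>C i\<close> and a part of \<open>I\<close>.\<close>

lemma lnil_subset_vsum:
  assumes chain: "C 0 = A" "C n = UNIV"
    "\<And>i. i < n \<Longrightarrow> maximal_subalgebra (C i) (C (Suc i)) \<and> self_normalizing (C i) (C (Suc i))"
    and A: "subalgebra A" "A \<subseteq> lnil {0} A"
    and I: "is_ideal I" and J: "is_ideal J" "J \<subseteq> lnil I J" "UNIV \<subseteq> lnil J UNIV" and IJ: "I \<subseteq> J"
  shows "lnil I A \<subseteq> vsum A I"
proof -
  note subA = subalgebra_subspace[OF A(1)]
  note subI = is_idealD(1)[OF I] and subJ = is_idealD(1)[OF J(1)]
  have AC: "i \<le> n \<Longrightarrow> A \<subseteq> C i" for i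
  proof (induction i)
    case (Suc i)
    then show ?case using maximal_subalgebraD(3)[OF chain(3)[of i, THEN conjunct1]] by auto
  qed (use chain in simp)
  have CJ: "i \<le> n \<Longrightarrow> C i \<subseteq> vsum A J" for i
  proof (induction i)
    case 0
    then show ?case using chain subset_vsum(1)[OF subA subJ] by simp
  next
    case (Suc i)
    then have "C (Suc i) = vsum (C i) (J \<inter> C (Suc i))"
      using self_normalizing_vsum_ideal[of "C i" "C (Suc i)" J] chain(3)[of i] J by auto
    also have "\<dots> \<subseteq> vsum A J"
      by (rule vsum_subset[OF subspace_vsum[OF subA subJ]])
        (use Suc subset_vsum(2)[OF subA subJ] in auto)
    finally show ?case .
  qed
  have I_lnil: "I \<subseteq> lnil I A"
    unfolding lnil_def by (metis UN_upper UNIV_I lseries.simps(1))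
  have sub_lnil: "subspace (lnil I A)"
    by (rule subspace_lnil[OF subI]) (use is_idealD(3)[OF I] in blast)
  have "i \<le> n \<Longrightarrow> C i \<inter> lnil I A \<subseteq> vsum A I" for i
  proof (induction i)
    case 0
    then show ?case using chain subset_vsum(1)[OF subA subI] by auto
  next
    case (Suc i)
    then have i: "i < n" by simp
    note M = chain(3)[OF i, THEN conjunct1] chain(3)[OF i, THEN conjunct2]
    show ?case
    proof (cases "I \<inter> C (Suc i) \<subseteq> C i")
      case True
      have "C (Suc i) \<inter> lnil I A \<subseteq> C i"
        by (rule lnil_subset_maximal[OF M I J(1,2) A(1) _ A(2) _ True IJ])
          (use AC[of i] CJ[of "Suc i"] i in auto)
      then show ?thesis using Suc by auto
    next
      case False
      then have eq: "vsum (C i) (I \<inter> C (Suc i)) = C (Suc i)"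
        using maximal_ideal_cases[OF M(1) I] by blast
      show ?thesis
      proof
        fix x assume x: "x \<in> C (Suc i) \<inter> lnil I A"
        then have "x \<in> vsum (C i) (I \<inter> C (Suc i))" using eq by simp
        then obtain m w where mw: "m \<in> C i" "w \<in> I \<inter> C (Suc i)" "x = m + w"
          by (rule vsum_elim)
        have "x - w \<in> lnil I A" using x mw(2) I_lnil by (auto intro: subspace_diff[OF sub_lnil])
        then have "m \<in> vsum A I" using Suc mw by auto
        then show "x \<in> vsum A I"
          using mw subset_vsum(2)[OF subA subI] subspace_add[OF subspace_vsum[OF subA subI]] by auto
      qed
    qed
  qed
  from this[of n] show ?thesis using chain(2) by simp
qed

subsection \<open>The Cartan subalgebra\<close>

text \<open>The null component \<open>D\<close> of \<open>A\<close> is the only candidate: nilpotent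
  subalgebras containing \<open>A\<close> lie in \<open>D\<close>, and once \<open>D\<close> is
  nilpotent, no proper subalgebra of it is self-normalizing in it.\<close>

theorem ex1_cartan_lnil:
  assumes A: "subalgebra A" "A \<subseteq> lnil {0} A"
    and I: "is_ideal I" "I \<subseteq> lnil {0} I" and AI: "lnil {0} A \<subseteq> vsum A I"
  shows "\<exists>!C. cartan_subalgebra C \<and> A \<subseteq> C"
proof -
  define D where "D = lnil {0} A"
  note subA = subalgebra_subspace[OF A(1)]
  note subI = is_idealD(1)[OF I(1)]
  have subD: "subspace D" unfolding D_def by (rule subspace_lnil) auto
  have D: "subalgebra D"
    using subD lnil_mult[of "{0}" UNIV A] subalgebra_UNIV
    by (auto simp: subalgebra_def D_def)
  note multD = subalgebra_mult[OF D]
  have AD: "A \<subseteq> D" using A by (simp add: D_def)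
  have split: "\<exists>a\<in>A. \<exists>k\<in>I \<inter> D. d = a + k" if d: "d \<in> D" for d
  proof -
    have "d \<in> vsum A I" using d AI by (auto simp: D_def)
    then obtain a k where ak: "a \<in> A" "k \<in> I" "d = a + k" by (rule vsum_elim)
    have "d - a \<in> D" using ak(1) d AD by (auto intro: subspace_diff[OF subD])
    then have "k \<in> D" using ak(3) by simp
    then show ?thesis using ak by blast
  qed
  \<comment> \<open>Each term of the series of \<open>I\<close> within \<open>I \<inter> D\<close>
    is preserved by \<open>A\<close>, which acts nilpotently on it, and lowered by
    \<open>I \<inter> D\<close>; and \<open>D = A + (I \<inter> D)\<close>.\<close>
  have "lseries {0} I j \<inter> I \<inter> D \<subseteq> lnil {0} D" for j
  proof (induction j)
    case 0
    then show ?case using subspace_0[OF subspace_lnil[of "{0}" D]] by auto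
  next
    case (Suc j)
    show ?case
    proof (rule lnil_add_ideal[OF split])
      show "p \<cdot> v \<in> lseries {0} I (Suc j) \<inter> I \<inter> D"
        if "p \<in> A" "v \<in> lseries {0} I (Suc j) \<inter> I \<inter> D" for p v
        using that is_idealD(3,4)[OF I(1)] multD AD lseries_stable[of I p "{0}" v "Suc j"] by auto
      show "k \<cdot> v \<in> lnil {0} D"
        if "k \<in> I \<inter> D" "v \<in> lseries {0} I (Suc j) \<inter> I \<inter> D" for k v
        using that is_idealD(3)[OF I(1)] multD Suc by auto
    qed (auto simp: D_def)
  qed
  then have "lnil {0} I \<inter> I \<inter> D \<subseteq> lnil {0} D" by (auto simp: lnil_def[of "{0}" I])
  then have KD: "I \<inter> D \<subseteq> lnil {0} D" using I(2) by blast
  \<comment> \<open>The same splitting on all of \<open>D\<close>: products with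
    \<open>I \<inter> D\<close> on the left fall into \<open>I \<inter> D\<close>, which is covered
    by \<open>KD\<close>.\<close>
  have nilD: "D \<subseteq> lnil {0} D"
  proof (rule lnil_add_ideal[OF split])
    show "k \<cdot> v \<in> lnil {0} D" if "k \<in> I \<inter> D" "v \<in> D" for k v
      using that is_idealD(4)[OF I(1)] multD KD by auto
  qed (use AD multD in \<open>auto simp: D_def\<close>)
  have normD: "normalizer UNIV D \<subseteq> D"
  proof
    fix x assume x: "x \<in> normalizer UNIV D"
    \<comment> \<open>With a uniform exponent, \<open>A \<cdot> x \<subseteq> D\<close> is
      containment in a single term of the series, so \<open>x\<close> lies in the next term.\<close>
    obtain n where n: "lnil {0} A = lseries {0} A n" by (rule lnil_uniform[of "{0}" A]) (use that in auto)
    have "x \<in> lseries {0} A (Suc n)"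
      using x AD n by (auto simp: normalizer_def D_def)
    then show "x \<in> D" unfolding D_def lnil_def by blast
  qed
  have "D \<subseteq> normalizer UNIV D" using multD by (auto simp: normalizer_def)
  then have "cartan_subalgebra D"
    using D nilD normD nilpotent_restrict_iff[OF D]
    by (auto simp: cartan_subalgebra_def self_normalizing_def)
  moreover have "C = D" if C: "cartan_subalgebra C" "A \<subseteq> C" for C
  proof -
    have alg: "subalgebra C" and nil: "C \<subseteq> lnil {0} C" and norm: "normalizer UNIV C = C"
      using C nilpotent_restrict_iff by (auto simp: cartan_subalgebra_def self_normalizing_def)
    have CD: "C \<subseteq> D" using nil lnil_mono[of "{0}" "{0}" A C] C(2) by (auto simp: D_def)
    have "self_normalizing C D"
      using norm CD unfolding self_normalizing_def normalizer_def by blast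
    moreover have "D \<subseteq> lnil C C"
      using nilD lnil_mono[of "{0}" C C D] CD subspace_0[OF subalgebra_subspace[OF alg]] by auto
    ultimately show ?thesis using self_normalizing_eq[OF alg D CD] by blast
  qed
  ultimately show ?thesis using AD by blast
qed

text \<open>Capping the index at \<open>t\<close> continues the series by constant terms with zero
  factors, so any length up to three can be treated as three.\<close>

lemma nilpotent_seriesD:
  assumes "nilpotent_series t I"
  shows "is_ideal (I (min k t))" "I (min k t) \<subseteq> I (min (Suc k) t)"
    "I (min (Suc k) t) \<subseteq> lnil (I (min k t)) (I (min (Suc k) t))"
proof -
  have ideal: "is_ideal (I (min k t))" for k
    using assms by (auto simp: nilpotent_series_def)
  show "is_ideal (I (min k t))" by (rule ideal)
  show "I (min k t) \<subseteq> I (min (Suc k) t)"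
    using assms by (cases "k < t") (auto simp: nilpotent_series_def min_def)
  show "I (min (Suc k) t) \<subseteq> lnil (I (min k t)) (I (min (Suc k) t))"
  proof (cases "k < t")
    case True
    then have "nilpotent_algebra (quotient_algebra (I (min (Suc k) t)) (I (min k t)))"
      using assms by (simp add: nilpotent_series_def)
    then show ?thesis using nilpotent_quotientD[OF ideal is_idealD(2)[OF ideal]] by blast
  next
    case False
    then have "min (Suc k) t = min k t" by simp
    then show ?thesis unfolding lnil_def by (metis UN_upper UNIV_I lseries.simps(1))
  qed
qed

text \<open>\<open>N 1\<close> and \<open>N 2\<close> serve as \<open>I\<close> and \<open>J\<close>
  in \<open>lnil_subset_vsum\<close>, which uses the two upper nilpotent factors; the lowest factor
  makes \<open>N 1\<close> nilpotent, as \<open>ex1_cartan_lnil\<close> requires.\<close>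

theorem ex1_cartan_M_set:
  assumes "nilpotent_series t I" "t \<le> 3" "A \<in> M_set"
  shows "\<exists>!C. cartan_subalgebra C \<and> A \<subseteq> C"
proof -
  define N where "N k = I (min k t)" for k
  note N = nilpotent_seriesD[OF assms(1), folded N_def]
  have ends: "N 0 = {0}" "N 3 = UNIV"
    using assms(1,2) by (simp_all add: N_def nilpotent_series_def min_def)
  have A: "subalgebra A" "A \<subseteq> lnil {0} A"
    using assms(3) nilpotent_if_no_self_normalizing_maximal[of A] by (auto simp: M_set_def)
  obtain n C where C: "C 0 = A" "C n = UNIV"
    "\<And>i. i < n \<Longrightarrow> maximal_subalgebra (C i) (C (Suc i)) \<and> self_normalizing (C i) (C (Suc i))"
    using assms(3) unfolding M_set_def by blast
  have "lnil (N 1) A \<subseteq> vsum A (N 1)"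
    by (rule lnil_subset_vsum[OF C A N(1) N(1), of 2])
      (use N(2)[of 1] N(3)[of 1] N(3)[of 2] ends in \<open>simp_all add: numeral_2_eq_2 numeral_3_eq_3\<close>)
  moreover have "lnil {0} A \<subseteq> lnil (N 1) A"
    by (rule lnil_mono) (use N(2)[of 0] ends in auto)
  ultimately show ?thesis
    using ex1_cartan_lnil[OF A N(1), of 1] N(3)[of 0] ends by auto
qed

end

theorem theorem9:
  fixes scale :: "'k::field \<Rightarrow> 'v::ab_group_add \<Rightarrow> 'v"
    and mult :: "'v \<Rightarrow> 'v \<Rightarrow> 'v"
    and t :: nat
    and A :: "'v set"
  assumes "leibniz_algebra scale mult"
    and "leibniz_algebra.nilpotent_of_length scale mult t"
    and "t \<le> 3"
    and "A \<in> leibniz_algebra.M_set scale mult"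
  shows "\<exists>!C. leibniz_algebra.cartan_subalgebra scale mult C \<and> A \<subseteq> C"
proof -
  obtain I where "leibniz_algebra.nilpotent_series scale mult t I"
    using assms(2) leibniz_algebra.nilpotent_of_length_def[OF assms(1)] by blast
  then show ?thesis
    using leibniz_algebra.ex1_cartan_M_set[OF assms(1)] assms(3,4) by blast
qed

end
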